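(* A tower of rings $A\,|\,B\,|\,C$ is right depth three if and only if the natural $A$-$C$-bimodules $A\otimes_B A$ and $A$ are H-equivalent.
   Context: Rings have identity; a tower of rings $A\,|\,B\,|\,C$ is a pair of unital ring homomorphisms $C\to B\to A$, inducing natural bimodule structures. $X\oplus *\cong Y$ means $X$ is isomorphic to a direct summand of $Y$. The tower is right depth three if for some positive integer $N$, $A\otimes_B A\oplus *\cong A^N$ as $A$-$C$-bimodules. Two modules (or bimodules) $M$ and $M'$ are H-equivalent if $M\oplus *\cong (M')^n$ and $M'\oplus *\cong M^m$ for some positive integers $n,m$. *)

theory Defs
  imports "HOL-Algebra.Ring" "HOL-Algebra.AbelCoset" "HOL-Algebra.Module"
    "HOL-Algebra.Generated_Groups" "HOL-Algebra.Free_Abelian_Groups"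
begin

text \<open>
  As for the library's \<open>module\<close> records, the multiplicative fields \<open>mult\<close> and \<open>one\<close> inherited
  from \<open>ring\<close> are irrelevant for (bi)modules; they are left \<open>undefined\<close> below.
  The library locale \<open>module\<close> is restricted to commutative rings and is therefore not used.
\<close>

record ('r, 'm, 's) bimodule = "('r, 'm) module" +
  rsmult :: "'m \<Rightarrow> 's \<Rightarrow> 'm"  (infixl "\<odot>\<^sub>r\<index>" 70)

locale bimodule = R?: ring R + S?: ring S + M?: abelian_group M
  for R (structure) and S (structure) and M (structure) +
  assumes lsmult_closed:
      "\<lbrakk>r \<in> carrier R; x \<in> carrier M\<rbrakk> \<Longrightarrow> r \<odot>\<^bsub>M\<^esub> x \<in> carrier M"
    and lsmult_l_distr:
      "\<lbrakk>r \<in> carrier R; r' \<in> carrier R; x \<in> carrier M\<rbrakk>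
        \<Longrightarrow> (r \<oplus>\<^bsub>R\<^esub> r') \<odot>\<^bsub>M\<^esub> x = r \<odot>\<^bsub>M\<^esub> x \<oplus>\<^bsub>M\<^esub> r' \<odot>\<^bsub>M\<^esub> x"
    and lsmult_r_distr:
      "\<lbrakk>r \<in> carrier R; x \<in> carrier M; y \<in> carrier M\<rbrakk>
        \<Longrightarrow> r \<odot>\<^bsub>M\<^esub> (x \<oplus>\<^bsub>M\<^esub> y) = r \<odot>\<^bsub>M\<^esub> x \<oplus>\<^bsub>M\<^esub> r \<odot>\<^bsub>M\<^esub> y"
    and lsmult_assoc:
      "\<lbrakk>r \<in> carrier R; r' \<in> carrier R; x \<in> carrier M\<rbrakk>
        \<Longrightarrow> (r \<otimes>\<^bsub>R\<^esub> r') \<odot>\<^bsub>M\<^esub> x = r \<odot>\<^bsub>M\<^esub> (r' \<odot>\<^bsub>M\<^esub> x)"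
    and lsmult_one:
      "x \<in> carrier M \<Longrightarrow> \<one>\<^bsub>R\<^esub> \<odot>\<^bsub>M\<^esub> x = x"
    and rsmult_closed:
      "\<lbrakk>x \<in> carrier M; s \<in> carrier S\<rbrakk> \<Longrightarrow> x \<odot>\<^sub>r\<^bsub>M\<^esub> s \<in> carrier M"
    and rsmult_r_distr:
      "\<lbrakk>x \<in> carrier M; s \<in> carrier S; s' \<in> carrier S\<rbrakk>
        \<Longrightarrow> x \<odot>\<^sub>r\<^bsub>M\<^esub> (s \<oplus>\<^bsub>S\<^esub> s') = x \<odot>\<^sub>r\<^bsub>M\<^esub> s \<oplus>\<^bsub>M\<^esub> x \<odot>\<^sub>r\<^bsub>M\<^esub> s'"
    and rsmult_l_distr:
      "\<lbrakk>x \<in> carrier M; y \<in> carrier M; s \<in> carrier S\<rbrakk>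
        \<Longrightarrow> (x \<oplus>\<^bsub>M\<^esub> y) \<odot>\<^sub>r\<^bsub>M\<^esub> s = x \<odot>\<^sub>r\<^bsub>M\<^esub> s \<oplus>\<^bsub>M\<^esub> y \<odot>\<^sub>r\<^bsub>M\<^esub> s"
    and rsmult_assoc:
      "\<lbrakk>x \<in> carrier M; s \<in> carrier S; s' \<in> carrier S\<rbrakk>
        \<Longrightarrow> x \<odot>\<^sub>r\<^bsub>M\<^esub> (s \<otimes>\<^bsub>S\<^esub> s') = (x \<odot>\<^sub>r\<^bsub>M\<^esub> s) \<odot>\<^sub>r\<^bsub>M\<^esub> s'"
    and rsmult_one:
      "x \<in> carrier M \<Longrightarrow> x \<odot>\<^sub>r\<^bsub>M\<^esub> \<one>\<^bsub>S\<^esub> = x"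
    and smult_compat:
      "\<lbrakk>r \<in> carrier R; x \<in> carrier M; s \<in> carrier S\<rbrakk>
        \<Longrightarrow> (r \<odot>\<^bsub>M\<^esub> x) \<odot>\<^sub>r\<^bsub>M\<^esub> s = r \<odot>\<^bsub>M\<^esub> (x \<odot>\<^sub>r\<^bsub>M\<^esub> s)"

definition bimodule_hom ::
    "('r, 'x) ring_scheme \<Rightarrow> ('s, 'y) ring_scheme \<Rightarrow> ('r, 'm, 's) bimodule \<Rightarrow> ('r, 'n, 's) bimodule
      \<Rightarrow> ('m \<Rightarrow> 'n) set" where
  "bimodule_hom R S M N = {f \<in> carrier M \<rightarrow> carrier N.
      (\<forall>x\<in>carrier M. \<forall>y\<in>carrier M. f (x \<oplus>\<^bsub>M\<^esub> y) = f x \<oplus>\<^bsub>N\<^esub> f y) \<and>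
      (\<forall>r\<in>carrier R. \<forall>x\<in>carrier M. f (r \<odot>\<^bsub>M\<^esub> x) = r \<odot>\<^bsub>N\<^esub> f x) \<and>
      (\<forall>x\<in>carrier M. \<forall>s\<in>carrier S. f (x \<odot>\<^sub>r\<^bsub>M\<^esub> s) = f x \<odot>\<^sub>r\<^bsub>N\<^esub> s)}"

definition bimodule_iso ::
    "('r, 'x) ring_scheme \<Rightarrow> ('s, 'y) ring_scheme \<Rightarrow> ('r, 'm, 's) bimodule \<Rightarrow> ('r, 'n, 's) bimodule
      \<Rightarrow> ('m \<Rightarrow> 'n) set" where
  "bimodule_iso R S M N = {f \<in> bimodule_hom R S M N. bij_betw f (carrier M) (carrier N)}"

definition subbimodule ::
    "('r, 'x) ring_scheme \<Rightarrow> ('s, 'y) ring_scheme \<Rightarrow> 'm set \<Rightarrow> ('r, 'm, 's) bimodule \<Rightarrow> bool" where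
  "subbimodule R S H M \<longleftrightarrow> additive_subgroup H M \<and>
      (\<forall>r\<in>carrier R. \<forall>x\<in>H. r \<odot>\<^bsub>M\<^esub> x \<in> H) \<and> (\<forall>x\<in>H. \<forall>s\<in>carrier S. x \<odot>\<^sub>r\<^bsub>M\<^esub> s \<in> H)"

definition direct_summand ::
    "('r, 'x) ring_scheme \<Rightarrow> ('s, 'y) ring_scheme \<Rightarrow> 'm set \<Rightarrow> ('r, 'm, 's) bimodule \<Rightarrow> bool" where
  "direct_summand R S H M \<longleftrightarrow> subbimodule R S H M \<and>
      (\<exists>K. subbimodule R S K M \<and> H <+>\<^bsub>M\<^esub> K = carrier M \<and> H \<inter> K = {\<zero>\<^bsub>M\<^esub>})"

text \<open>\<open>iso_to_summand R S X Y\<close> renders \<open>X \<oplus> * \<cong> Y\<close>.\<close>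

definition iso_to_summand ::
    "('r, 'x) ring_scheme \<Rightarrow> ('s, 'y) ring_scheme \<Rightarrow> ('r, 'm, 's) bimodule \<Rightarrow> ('r, 'n, 's) bimodule
      \<Rightarrow> bool" where
  "iso_to_summand R S X Y \<longleftrightarrow>
      (\<exists>H. direct_summand R S H Y \<and> bimodule_iso R S X (Y\<lparr>carrier := H\<rparr>) \<noteq> {})"

definition bimodule_power :: "('r, 'm, 's) bimodule \<Rightarrow> nat \<Rightarrow> ('r, nat \<Rightarrow> 'm, 's) bimodule" where
  "bimodule_power M n =
    \<lparr>carrier = {..<n} \<rightarrow>\<^sub>E carrier M,
     monoid.mult = undefined, one = undefined,
     ring.zero = (\<lambda>i\<in>{..<n}. \<zero>\<^bsub>M\<^esub>),
     add = (\<lambda>x y. \<lambda>i\<in>{..<n}. x i \<oplus>\<^bsub>M\<^esub> y i),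
     smult = (\<lambda>r x. \<lambda>i\<in>{..<n}. r \<odot>\<^bsub>M\<^esub> x i),
     rsmult = (\<lambda>x s. \<lambda>i\<in>{..<n}. x i \<odot>\<^sub>r\<^bsub>M\<^esub> s)\<rparr>"

definition H_equivalent ::
    "('r, 'x) ring_scheme \<Rightarrow> ('s, 'y) ring_scheme \<Rightarrow> ('r, 'm, 's) bimodule \<Rightarrow> ('r, 'n, 's) bimodule
      \<Rightarrow> bool" where
  "H_equivalent R S M M' \<longleftrightarrow>
      (\<exists>n>0. iso_to_summand R S M (bimodule_power M' n)) \<and>
      (\<exists>m>0. iso_to_summand R S M' (bimodule_power M m))"

text \<open>
  \<open>M \<otimes>\<^sub>B N\<close> is the free abelian group on \<open>carrier M \<times> carrier N\<close> modulo the subgroup generated by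
  the biadditivity and \<open>B\<close>-balancedness relations. The library writes free abelian groups
  as multiplicative \<open>monoid\<close> records whose operation is addition of finitely supported functions.
\<close>

definition tensor_relators ::
    "('b, 'x) ring_scheme \<Rightarrow> ('r, 'm, 'b) bimodule \<Rightarrow> ('b, 'n, 's) bimodule
      \<Rightarrow> ('m \<times> 'n \<Rightarrow>\<^sub>0 int) set" where
  "tensor_relators B M N =
    {frag_of (x \<oplus>\<^bsub>M\<^esub> x', y) - frag_of (x, y) - frag_of (x', y) | x x' y.
        x \<in> carrier M \<and> x' \<in> carrier M \<and> y \<in> carrier N} \<union>
    {frag_of (x, y \<oplus>\<^bsub>N\<^esub> y') - frag_of (x, y) - frag_of (x, y') | x y y'.
        x \<in> carrier M \<and> y \<in> carrier N \<and> y' \<in> carrier N} \<union>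
    {frag_of (x \<odot>\<^sub>r\<^bsub>M\<^esub> b, y) - frag_of (x, b \<odot>\<^bsub>N\<^esub> y) | x b y.
        x \<in> carrier M \<and> b \<in> carrier B \<and> y \<in> carrier N}"

definition tensor_kernel ::
    "('b, 'x) ring_scheme \<Rightarrow> ('r, 'm, 'b) bimodule \<Rightarrow> ('b, 'n, 's) bimodule
      \<Rightarrow> ('m \<times> 'n \<Rightarrow>\<^sub>0 int) set" where
  "tensor_kernel B M N =
    generate (free_Abelian_group (carrier M \<times> carrier N)) (tensor_relators B M N)"

text \<open>
  The actions are \<open>r (x \<otimes> y) = r x \<otimes> y\<close> and \<open>(x \<otimes> y) s = x \<otimes> y s\<close>, extended additively to the
  free abelian group by \<^const>\<open>frag_extend\<close>. The image of a coset \<open>X\<close> under such a map is in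
  general only a subset of a coset, hence the product with the kernel.
\<close>

definition tensor_product ::
    "('b, 'x) ring_scheme \<Rightarrow> ('r, 'm, 'b) bimodule \<Rightarrow> ('b, 'n, 's) bimodule
      \<Rightarrow> ('r, ('m \<times> 'n \<Rightarrow>\<^sub>0 int) set, 's) bimodule" where
  "tensor_product B M N =
    (let F = free_Abelian_group (carrier M \<times> carrier N); K = tensor_kernel B M N in
     \<lparr>carrier = carrier (F Mod K),
      monoid.mult = undefined, one = undefined,
      ring.zero = \<one>\<^bsub>F Mod K\<^esub>,
      add = (\<lambda>X Y. X \<otimes>\<^bsub>F Mod K\<^esub> Y),
      smult = (\<lambda>r X. K <#>\<^bsub>F\<^esub> (frag_extend (\<lambda>(x, y). frag_of (r \<odot>\<^bsub>M\<^esub> x, y)) ` X)),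
      rsmult = (\<lambda>X s. K <#>\<^bsub>F\<^esub> (frag_extend (\<lambda>(x, y). frag_of (x, y \<odot>\<^sub>r\<^bsub>N\<^esub> s)) ` X))\<rparr>)"

text \<open>The tower \<open>A | B | C\<close> is given by \<open>\<phi> : C \<rightarrow> B\<close> and \<open>\<psi> : B \<rightarrow> A\<close>, which need not be
  injective; the library's \<^const>\<open>ring_hom\<close> preserves the identity.\<close>

locale ring_tower = A?: ring A + B?: ring B + C?: ring C
  for A (structure) and B (structure) and C (structure) and \<phi> and \<psi> +
  assumes lower_hom: "\<phi> \<in> ring_hom C B"
    and upper_hom: "\<psi> \<in> ring_hom B A"

definition natural_bimodule ::
    "('a, 'x) ring_scheme \<Rightarrow> ('r \<Rightarrow> 'a) \<Rightarrow> ('s \<Rightarrow> 'a) \<Rightarrow> ('r, 'a, 's) bimodule" where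
  "natural_bimodule A f g =
    \<lparr>carrier = carrier A, monoid.mult = undefined, one = undefined,
     ring.zero = \<zero>\<^bsub>A\<^esub>, add = add A,
     smult = (\<lambda>r x. f r \<otimes>\<^bsub>A\<^esub> x), rsmult = (\<lambda>x s. x \<otimes>\<^bsub>A\<^esub> g s)\<rparr>"

definition tower_bimodule ::
    "('a, 'x) ring_scheme \<Rightarrow> ('c \<Rightarrow> 'b) \<Rightarrow> ('b \<Rightarrow> 'a) \<Rightarrow> ('a, 'a, 'c) bimodule" where
  "tower_bimodule A \<phi> \<psi> = natural_bimodule A (\<lambda>a. a) (\<psi> \<circ> \<phi>)"

definition tower_tensor ::
    "('a, 'x) ring_scheme \<Rightarrow> ('b, 'y) ring_scheme \<Rightarrow> ('c \<Rightarrow> 'b) \<Rightarrow> ('b \<Rightarrow> 'a)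
      \<Rightarrow> ('a, ('a \<times> 'a \<Rightarrow>\<^sub>0 int) set, 'c) bimodule" where
  "tower_tensor A B \<phi> \<psi> =
    tensor_product B (natural_bimodule A (\<lambda>a. a) \<psi>) (natural_bimodule A \<psi> (\<psi> \<circ> \<phi>))"

definition right_depth_three ::
    "('a, 'x) ring_scheme \<Rightarrow> ('b, 'y) ring_scheme \<Rightarrow> ('c, 'z) ring_scheme
      \<Rightarrow> ('c \<Rightarrow> 'b) \<Rightarrow> ('b \<Rightarrow> 'a) \<Rightarrow> bool" where
  "right_depth_three A B C \<phi> \<psi> \<longleftrightarrow>
    (\<exists>N>0. iso_to_summand A C (tower_tensor A B \<phi> \<psi>) (bimodule_power (tower_bimodule A \<phi> \<psi>) N))"

end

theory Submission
  imports Defs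
begin

text \<open>
  Depth three is one half of the H-equivalence. The other half holds for every tower: the
  bimodule map \<open>a \<mapsto> a \<otimes> 1\<close> is split by the multiplication \<open>A \<otimes>\<^sub>B A \<rightarrow> A\<close>, so \<open>A\<close> is a direct
  summand of \<open>A \<otimes>\<^sub>B A\<close>.
\<close>

section \<open>Bimodule homomorphisms and retracts\<close>

lemma bimodule_homI:
  assumes "\<And>x. x \<in> carrier M \<Longrightarrow> f x \<in> carrier N"
    and "\<And>x y. \<lbrakk>x \<in> carrier M; y \<in> carrier M\<rbrakk> \<Longrightarrow> f (x \<oplus>\<^bsub>M\<^esub> y) = f x \<oplus>\<^bsub>N\<^esub> f y"
    and "\<And>r x. \<lbrakk>r \<in> carrier R; x \<in> carrier M\<rbrakk> \<Longrightarrow> f (r \<odot>\<^bsub>M\<^esub> x) = r \<odot>\<^bsub>N\<^esub> f x"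
    and "\<And>x s. \<lbrakk>x \<in> carrier M; s \<in> carrier S\<rbrakk> \<Longrightarrow> f (x \<odot>\<^sub>r\<^bsub>M\<^esub> s) = f x \<odot>\<^sub>r\<^bsub>N\<^esub> s"
  shows "f \<in> bimodule_hom R S M N"
  using assms by (auto simp: bimodule_hom_def)

lemma bimodule_homD:
  assumes "f \<in> bimodule_hom R S M N"
  shows bimodule_hom_closed: "x \<in> carrier M \<Longrightarrow> f x \<in> carrier N"
    and bimodule_hom_add:
      "\<lbrakk>x \<in> carrier M; y \<in> carrier M\<rbrakk> \<Longrightarrow> f (x \<oplus>\<^bsub>M\<^esub> y) = f x \<oplus>\<^bsub>N\<^esub> f y"
    and bimodule_hom_smult:
      "\<lbrakk>r \<in> carrier R; x \<in> carrier M\<rbrakk> \<Longrightarrow> f (r \<odot>\<^bsub>M\<^esub> x) = r \<odot>\<^bsub>N\<^esub> f x"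
    and bimodule_hom_rsmult:
      "\<lbrakk>x \<in> carrier M; s \<in> carrier S\<rbrakk> \<Longrightarrow> f (x \<odot>\<^sub>r\<^bsub>M\<^esub> s) = f x \<odot>\<^sub>r\<^bsub>N\<^esub> s"
  using assms by (auto simp: bimodule_hom_def)

lemma bimodule_hom_group_hom:
  assumes "bimodule R S M" "bimodule R S N" "f \<in> bimodule_hom R S M N"
  shows "group_hom (add_monoid M) (add_monoid N) f"
proof -
  interpret M: bimodule R S M by fact
  interpret N: bimodule R S N by fact
  show ?thesis
    using assms(3)
    by (auto simp: group_hom_def group_hom_axioms_def hom_def bimodule_hom_def
        M.a_group N.a_group)
qed

lemma (in bimodule) lsmult_zero:
  assumes "r \<in> carrier R" shows "r \<odot>\<^bsub>M\<^esub> \<zero>\<^bsub>M\<^esub> = \<zero>\<^bsub>M\<^esub>"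
  using lsmult_r_distr[of r "\<zero>\<^bsub>M\<^esub>" "\<zero>\<^bsub>M\<^esub>"] lsmult_closed[of r "\<zero>\<^bsub>M\<^esub>"] assms by simp

lemma (in bimodule) rsmult_zero:
  assumes "s \<in> carrier S" shows "\<zero>\<^bsub>M\<^esub> \<odot>\<^sub>r\<^bsub>M\<^esub> s = \<zero>\<^bsub>M\<^esub>"
  using rsmult_l_distr[of "\<zero>\<^bsub>M\<^esub>" "\<zero>\<^bsub>M\<^esub>" s] rsmult_closed[of "\<zero>\<^bsub>M\<^esub>" s] assms by simp

text \<open>With \<open>g\<close> a left inverse, \<open>f\<close> is injective and \<open>Y\<close>
  splits as the image of \<open>f\<close> plus the kernel of \<open>g\<close>, the projection being
  \<open>f \<circ> g\<close>. A direct summand claim thereby becomes the construction of two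
  homomorphisms.\<close>

lemma retract_iso_to_summand:
  assumes X: "bimodule R S X" and Y: "bimodule R S Y"
    and f: "f \<in> bimodule_hom R S X Y" and g: "g \<in> bimodule_hom R S Y X"
    and gf: "\<And>x. x \<in> carrier X \<Longrightarrow> g (f x) = x"
  shows "iso_to_summand R S X Y"
proof -
  interpret X: bimodule R S X by fact
  interpret Y: bimodule R S Y by fact
  interpret f: group_hom "add_monoid X" "add_monoid Y" f
    by (rule bimodule_hom_group_hom[OF X Y f])
  interpret g: group_hom "add_monoid Y" "add_monoid X" g
    by (rule bimodule_hom_group_hom[OF Y X g])
  note f_rules = bimodule_homD[OF f] and g_rules = bimodule_homD[OF g]
  have f0: "f \<zero>\<^bsub>X\<^esub> = \<zero>\<^bsub>Y\<^esub>" and g0: "g \<zero>\<^bsub>Y\<^esub> = \<zero>\<^bsub>X\<^esub>"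
    using f.hom_one g.hom_one by simp_all
  define H where "H = f ` carrier X"
  define K where "K = {y \<in> carrier Y. g y = \<zero>\<^bsub>X\<^esub>}"
  have "additive_subgroup H Y"
    using f.img_is_subgroup by (simp add: additive_subgroup_def H_def)
  \<comment> \<open>Linearity of \<open>f\<close> is read from right to left: an action on
    \<open>f x\<close> is the image of an action on \<open>x\<close>.\<close>
  then have H: "subbimodule R S H Y"
    unfolding subbimodule_def H_def
    by (auto simp flip: f_rules(3,4) simp: X.lsmult_closed X.rsmult_closed)
  have "additive_subgroup K Y"
    using g.subgroup_kernel by (simp add: additive_subgroup_def K_def kernel_def)
  then have K: "subbimodule R S K Y"
    unfolding subbimodule_def K_def
    by (auto simp: g_rules X.lsmult_zero X.rsmult_zero Y.lsmult_closed Y.rsmult_closed)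
  have "y \<in> H <+>\<^bsub>Y\<^esub> K" if y: "y \<in> carrier Y" for y
  proof -
    have fgy: "f (g y) \<in> carrier Y"
      using f_rules(1) g_rules(1) y by blast
    \<comment> \<open>The kernel component of \<open>y\<close>: what remains after its projection
      \<open>f (g y)\<close> to \<open>H\<close>.\<close>
    define z where "z = \<ominus>\<^bsub>Y\<^esub> f (g y) \<oplus>\<^bsub>Y\<^esub> y"
    have z: "z \<in> carrier Y" using y fgy by (simp add: z_def)
    have eq: "f (g y) \<oplus>\<^bsub>Y\<^esub> z = y"
      unfolding z_def using fgy y by (simp flip: Y.M.add.m_assoc add: Y.M.r_neg)
    \<comment> \<open>On applying \<open>g\<close> to \<open>eq\<close>, the term
      \<open>g (f (g y))\<close> collapses to \<open>g y\<close>; cancelling it leaves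
      \<open>g z\<close> equal to zero.\<close>
    have "g y \<oplus>\<^bsub>X\<^esub> g z = g y"
      using g_rules(2)[OF fgy z] eq gf[OF g_rules(1)[OF y]] by simp
    then have "g z = \<zero>\<^bsub>X\<^esub>"
      using g_rules(1)[OF y] g_rules(1)[OF z] by simp
    with z have "z \<in> K" by (simp add: K_def)
    moreover have "f (g y) \<in> H"
      using g_rules(1)[OF y] by (simp add: H_def)
    ultimately show ?thesis
      using eq by (force simp: set_add_def')
  qed
  moreover have "H <+>\<^bsub>Y\<^esub> K \<subseteq> carrier Y"
    using f_rules(1) by (auto simp: set_add_def' H_def K_def)
  ultimately have "H <+>\<^bsub>Y\<^esub> K = carrier Y" by blast
  \<comment> \<open>A common element is some \<open>f x\<close> with \<open>g (f x)\<close> zero,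
    but \<open>g (f x)\<close> is \<open>x\<close>.\<close>
  moreover have "H \<inter> K = {\<zero>\<^bsub>Y\<^esub>}"
    using f0 g0 gf by (force simp: H_def K_def)
  ultimately have "direct_summand R S H Y"
    using H K by (auto simp: direct_summand_def)
  moreover have "f \<in> bimodule_iso R S X (Y\<lparr>carrier := H\<rparr>)"
    using f inj_on_inverseI[of "carrier X" g f] gf
    by (auto simp: bimodule_iso_def bimodule_hom_def bij_betw_def H_def)
  ultimately show ?thesis
    by (auto simp: iso_to_summand_def)
qed

section \<open>Finite powers, and bimodules given by ring homomorphisms\<close>

lemma bimodule_power_bimodule:
  assumes "bimodule R S M"
  shows "bimodule R S (bimodule_power M n)"
proof -
  interpret M: bimodule R S M by fact
  \<comment> \<open>Elements of a power are extensional functions, so every law reduces to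
    coordinates below \<open>n\<close>. The variant \<open>eq\<close> allows an arbitrary element on
    the right-hand side.\<close>
  have eq': "(\<lambda>i\<in>{..<n}. f i) = (\<lambda>i\<in>{..<n}. g i) \<longleftrightarrow> (\<forall>i<n. f i = g i)" for f g
    by (auto simp: fun_eq_iff)
  have eq: "(\<lambda>i\<in>{..<n}. f i) = x \<longleftrightarrow> (\<forall>i<n. f i = x i)" if "x \<in> extensional {..<n}" for f x
    using eq'[of f x] extensional_restrict[OF that] by simp
  note simps = bimodule_power_def PiE_iff eq eq'
  have "abelian_group (bimodule_power M n)"
  proof (rule abelian_groupI)
    fix x assume x: "x \<in> carrier (bimodule_power M n)"
    show "\<exists>y\<in>carrier (bimodule_power M n).
        y \<oplus>\<^bsub>bimodule_power M n\<^esub> x = \<zero>\<^bsub>bimodule_power M n\<^esub>"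
      using x
      by (intro bexI[of _ "\<lambda>i\<in>{..<n}. \<ominus>\<^bsub>M\<^esub> x i"]) (simp_all add: simps M.l_neg)
  qed (simp_all add: simps M.a_ac)
  moreover have "bimodule_axioms R S (bimodule_power M n)"
    by unfold_locales
      (simp_all add: simps M.lsmult_closed M.rsmult_closed
        M.lsmult_l_distr M.lsmult_r_distr M.lsmult_assoc M.lsmult_one
        M.rsmult_l_distr M.rsmult_r_distr M.rsmult_assoc M.rsmult_one M.smult_compat)
  ultimately show ?thesis
    by (intro bimodule.intro M.R.ring_axioms M.S.ring_axioms)
qed

text \<open>One coordinate suffices: the diagonal copy of \<open>f\<close>, followed by
  \<open>g\<close> on coordinate 0, is the identity on \<open>X\<close>. Positivity of
  \<open>n\<close> guarantees that this coordinate exists.\<close>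

lemma retract_iso_to_summand_power:
  assumes X: "bimodule R S X" and Y: "bimodule R S Y"
    and f: "f \<in> bimodule_hom R S X Y" and g: "g \<in> bimodule_hom R S Y X"
    and gf: "\<And>x. x \<in> carrier X \<Longrightarrow> g (f x) = x" and n: "n > 0"
  shows "iso_to_summand R S X (bimodule_power Y n)"
proof (rule retract_iso_to_summand[OF X bimodule_power_bimodule[OF Y]])
  show "(\<lambda>x. \<lambda>i\<in>{..<n}. f x) \<in> bimodule_hom R S X (bimodule_power Y n)"
    using f by (auto simp: bimodule_hom_def bimodule_power_def Pi_def intro!: restrict_ext)
  have "y 0 \<in> carrier Y" if "y \<in> {..<n} \<rightarrow>\<^sub>E carrier Y" for y
    using that n by (auto dest: PiE_mem)
  then show "(\<lambda>y. g (y 0)) \<in> bimodule_hom R S (bimodule_power Y n) X"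
    using g n by (auto simp: bimodule_hom_def bimodule_power_def)
qed (use gf n in auto)

text \<open>Covers both tensor factors and \<open>tower_bimodule\<close> at once; the two actions
  commute by associativity of \<open>A\<close>.\<close>

lemma natural_bimodule_bimodule:
  assumes "ring A" "ring R" "ring S" "f \<in> ring_hom R A" "g \<in> ring_hom S A"
  shows "bimodule R S (natural_bimodule A f g)"
proof -
  interpret A: ring A by fact
  note f = ring_hom_closed[OF assms(4)] ring_hom_add[OF assms(4)] ring_hom_mult[OF assms(4)]
    ring_hom_one[OF assms(4)]
  note g = ring_hom_closed[OF assms(5)] ring_hom_add[OF assms(5)] ring_hom_mult[OF assms(5)]
    ring_hom_one[OF assms(5)]
  have "abelian_group (natural_bimodule A f g)"
    using A.a_inv_closed A.l_neg
    by (intro abelian_groupI) (auto simp: natural_bimodule_def A.a_ac)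
  moreover have "bimodule_axioms R S (natural_bimodule A f g)"
    by unfold_locales
      (auto simp: natural_bimodule_def f g A.l_distr A.r_distr A.m_assoc)
  ultimately show ?thesis
    by (intro bimodule.intro assms)
qed

section \<open>Tensor products of bimodules\<close>

text \<open>An endomorphism preserving \<open>H\<close> sends the coset of \<open>x\<close> into
  that of \<open>h x\<close>, possibly not onto it; multiplying by \<open>H\<close> fills the gap.
  This allows the actions of \<open>tensor_product\<close> to be computed on
  representatives.\<close>

lemma (in normal) set_mult_image_rcos:
  assumes h: "h \<in> hom G G" and hH: "h ` H \<subseteq> H" and x: "x \<in> carrier G"
  shows "H <#> h ` (H #> x) = H #> h x"
proof -
  have hx: "h x \<in> carrier G" using hom_in_carrier[OF h x] .
  show ?thesis
  proof
    show "H <#> h ` (H #> x) \<subseteq> H #> h x"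
    proof (clarsimp simp: set_mult_def r_coset_def)
      fix a b assume a: "a \<in> H" and b: "b \<in> H"
      have "h b \<in> H" using b hH by blast
      then have "a \<otimes> h (b \<otimes> x) = (a \<otimes> h b) \<otimes> h x"
        using a b x hx by (simp add: hom_mult[OF h] m_assoc)
      then show "\<exists>c\<in>H. a \<otimes> h (b \<otimes> x) = c \<otimes> h x"
        using a \<open>h b \<in> H\<close> by blast
    qed
    show "H #> h x \<subseteq> H <#> h ` (H #> x)"
    proof
      fix z assume "z \<in> H #> h x"
      then obtain a where "a \<in> H" "z = a \<otimes> h x" by (auto simp: r_coset_def)
      \<comment> \<open>Since \<open>x\<close> lies in its own coset, the factor from
        \<open>H\<close> alone already reaches every element.\<close>
      moreover have "h x \<in> h ` (H #> x)"
        using rcos_self[OF x subgroup_axioms] by (rule imageI)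
      ultimately show "z \<in> H <#> h ` (H #> x)"
        unfolding set_mult_def by blast
    qed
  qed
qed

locale tensor = M?: bimodule R B M + N?: bimodule B S N
  for R (structure) and B (structure) and S (structure)
    and M :: "('a, 'e, 'c) bimodule" (structure) and N :: "('c, 'i, 'g) bimodule" (structure)
begin

section \<open>The quotient group and its elementary tensors\<close>

abbreviation "F \<equiv> free_Abelian_group (carrier M \<times> carrier N)"
abbreviation "K \<equiv> tensor_kernel B M N"
abbreviation "T \<equiv> tensor_product B M N"

text \<open>The elementary tensor of \<open>x\<close> and \<open>y\<close>, as the class of a free
  generator.\<close>

definition tens where "tens x y = K #>\<^bsub>F\<^esub> frag_of (x, y)"

lemma T_FactGroup:
  "carrier T = carrier (F Mod K)" "add T = mult (F Mod K)" "\<zero>\<^bsub>T\<^esub> = \<one>\<^bsub>F Mod K\<^esub>"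
  by (simp_all add: tensor_product_def Let_def)

lemma relator_intros:
  "\<lbrakk>x \<in> carrier M; x' \<in> carrier M; y \<in> carrier N\<rbrakk> \<Longrightarrow>
    frag_of (x \<oplus>\<^bsub>M\<^esub> x', y) - frag_of (x, y) - frag_of (x', y) \<in> tensor_relators B M N"
  "\<lbrakk>x \<in> carrier M; y \<in> carrier N; y' \<in> carrier N\<rbrakk> \<Longrightarrow>
    frag_of (x, y \<oplus>\<^bsub>N\<^esub> y') - frag_of (x, y) - frag_of (x, y') \<in> tensor_relators B M N"
  "\<lbrakk>x \<in> carrier M; b \<in> carrier B; y \<in> carrier N\<rbrakk> \<Longrightarrow>
    frag_of (x \<odot>\<^sub>r\<^bsub>M\<^esub> b, y) - frag_of (x, b \<odot>\<^bsub>N\<^esub> y) \<in> tensor_relators B M N"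
  unfolding tensor_relators_def by blast+

lemma relators_subset: "tensor_relators B M N \<subseteq> carrier F"
proof -
  have diff: "a - b \<in> carrier F" if "a \<in> carrier F" "b \<in> carrier F" for a b
    using that keys_diff[of a b] by auto
  show ?thesis
    unfolding tensor_relators_def
    by (auto simp del: carrier_free_Abelian_group_iff intro!: diff
        simp: M.rsmult_closed N.lsmult_closed)
qed

lemma subgroup_K: "subgroup K F"
  unfolding tensor_kernel_def
  by (rule group.generate_is_subgroup[OF group_free_Abelian_group relators_subset])

sublocale K: normal K F
  using comm_group.normal_iff_subgroup[OF abelian_free_Abelian_group] subgroup_K by blast

lemma abelian_group_T: "abelian_group T"
proof -
  interpret Q: comm_group "F Mod K"
    by (rule comm_group.abelian_FactGroup[OF abelian_free_Abelian_group subgroup_K])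
  \<comment> \<open>The quotient operations stay folded, so the laws of \<open>Q\<close> carry over
    to \<open>T\<close> without inspecting cosets.\<close>
  show ?thesis
    using Q.l_inv_ex
    by (intro abelian_groupI) (simp_all add: T_FactGroup Q.m_ac del: mult_FactGroup one_FactGroup)
qed

sublocale T: abelian_group T
  by (rule abelian_group_T)

lemma carrier_T: "carrier T = (\<lambda>u. K #>\<^bsub>F\<^esub> u) ` carrier F"
  using carrier_FactGroup[of F K] by (simp add: tensor_product_def Let_def)

lemma rcos_add:
  "\<lbrakk>u \<in> carrier F; v \<in> carrier F\<rbrakk> \<Longrightarrow> (K #>\<^bsub>F\<^esub> u) \<oplus>\<^bsub>T\<^esub> (K #>\<^bsub>F\<^esub> v) = K #>\<^bsub>F\<^esub> (u + v)"
  using K.rcos_sum[of u v] by (simp add: tensor_product_def Let_def)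

lemma tens_closed [simp]: "\<lbrakk>x \<in> carrier M; y \<in> carrier N\<rbrakk> \<Longrightarrow> tens x y \<in> carrier T"
  by (auto simp: tens_def carrier_T)

lemma rcos_eqI:
  assumes "u - v \<in> K" "u \<in> carrier F" "v \<in> carrier F"
  shows "K #>\<^bsub>F\<^esub> u = K #>\<^bsub>F\<^esub> v"
proof -
  \<comment> \<open>The operation of \<open>F\<close> is addition of finitely supported functions,
    so a difference in \<open>K\<close> exhibits \<open>u\<close> in the coset of
    \<open>v\<close>.\<close>
  have "u = (u - v) \<otimes>\<^bsub>F\<^esub> v" by simp
  then have "u \<in> K #>\<^bsub>F\<^esub> v" using assms(1) unfolding r_coset_def by blast
  then show ?thesis using K.repr_independence[OF _ assms(3) subgroup_K] by simp
qed

lemma relator_in_K: "u \<in> tensor_relators B M N \<Longrightarrow> u \<in> K"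
  by (simp add: tensor_kernel_def generate.incl)

lemma tens_add_left:
  assumes "x \<in> carrier M" "x' \<in> carrier M" "y \<in> carrier N"
  shows "tens (x \<oplus>\<^bsub>M\<^esub> x') y = tens x y \<oplus>\<^bsub>T\<^esub> tens x' y"
proof -
  \<comment> \<open>Rewritten as two successive subtractions, this difference is literally a
    relator.\<close>
  have "frag_of (x \<oplus>\<^bsub>M\<^esub> x', y) - (frag_of (x, y) + frag_of (x', y)) \<in> K"
    unfolding diff_diff_eq[symmetric]
    using assms by (intro relator_in_K) (simp add: relator_intros)
  moreover have "frag_of (x, y) + frag_of (x', y) \<in> carrier F"
    using K.m_closed[of "frag_of (x, y)" "frag_of (x', y)"] assms by simp
  ultimately show ?thesis
    using assms unfolding tens_def by (simp add: rcos_add rcos_eqI)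
qed

lemma tens_add_right:
  assumes "x \<in> carrier M" "y \<in> carrier N" "y' \<in> carrier N"
  shows "tens x (y \<oplus>\<^bsub>N\<^esub> y') = tens x y \<oplus>\<^bsub>T\<^esub> tens x y'"
proof -
  have "frag_of (x, y \<oplus>\<^bsub>N\<^esub> y') - (frag_of (x, y) + frag_of (x, y')) \<in> K"
    unfolding diff_diff_eq[symmetric]
    using assms by (intro relator_in_K) (simp add: relator_intros)
  moreover have "frag_of (x, y) + frag_of (x, y') \<in> carrier F"
    using K.m_closed[of "frag_of (x, y)" "frag_of (x, y')"] assms by simp
  ultimately show ?thesis
    using assms unfolding tens_def by (simp add: rcos_add rcos_eqI)
qed

lemma tens_balanced:
  assumes "x \<in> carrier M" "b \<in> carrier B" "y \<in> carrier N"
  shows "tens (x \<odot>\<^sub>r\<^bsub>M\<^esub> b) y = tens x (b \<odot>\<^bsub>N\<^esub> y)"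
  unfolding tens_def
proof (rule rcos_eqI)
  show "frag_of (x \<odot>\<^sub>r\<^bsub>M\<^esub> b, y) - frag_of (x, b \<odot>\<^bsub>N\<^esub> y) \<in> K"
    using assms by (intro relator_in_K) (simp add: relator_intros)
qed (use assms in \<open>auto simp: M.rsmult_closed N.lsmult_closed\<close>)

section \<open>Universal property of the tensor product\<close>

text \<open>The uniqueness half: elementary tensors generate \<open>T\<close> as an abelian group.
  It later serves to prove action laws and linearity, each read as an equality of two additive
  maps.\<close>

lemma T_hom_eqI:
  assumes "abelian_group G"
    and f: "f \<in> hom (add_monoid T) (add_monoid G)"
    and g: "g \<in> hom (add_monoid T) (add_monoid G)"
    and eq: "\<And>x y. \<lbrakk>x \<in> carrier M; y \<in> carrier N\<rbrakk> \<Longrightarrow> f (tens x y) = g (tens x y)"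
    and t: "t \<in> carrier T"
  shows "f t = g t"
proof -
  interpret G: abelian_group G by fact
  interpret f: group_hom "add_monoid T" "add_monoid G" f
    using f by (auto simp: group_hom_def group_hom_axioms_def T.a_group G.a_group)
  interpret g: group_hom "add_monoid T" "add_monoid G" g
    using g by (auto simp: group_hom_def group_hom_axioms_def T.a_group G.a_group)
  obtain u where u: "Poly_Mapping.keys u \<subseteq> carrier M \<times> carrier N" and t: "t = K #>\<^bsub>F\<^esub> u"
    using t by (auto simp: carrier_T)
  from u have "f (K #>\<^bsub>F\<^esub> u) = g (K #>\<^bsub>F\<^esub> u)"
  proof (rule free_Abelian_group_induct)
    have "K #>\<^bsub>F\<^esub> 0 = \<zero>\<^bsub>T\<^esub>"
      using K.coset_mult_one[OF K.subset] by (simp add: tensor_product_def Let_def)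
    then show "f (K #>\<^bsub>F\<^esub> 0) = g (K #>\<^bsub>F\<^esub> 0)"
      using f.hom_one g.hom_one by simp
  next
    fix u v
    assume keys: "Poly_Mapping.keys u \<subseteq> carrier M \<times> carrier N"
        "Poly_Mapping.keys v \<subseteq> carrier M \<times> carrier N"
      and eq_u: "f (K #>\<^bsub>F\<^esub> u) = g (K #>\<^bsub>F\<^esub> u)"
      and eq_v: "f (K #>\<^bsub>F\<^esub> v) = g (K #>\<^bsub>F\<^esub> v)"
    \<comment> \<open>The induction passes through differences, whereas \<open>f\<close> and
      \<open>g\<close> are given as respecting sums. Writing \<open>u\<close> as
      \<open>(u - v) + v\<close> and cancelling the common value at \<open>v\<close> bridges the
      two.\<close>
    define d where "d = K #>\<^bsub>F\<^esub> (u - v)"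
    define w where "w = K #>\<^bsub>F\<^esub> v"
    have uv: "u - v \<in> carrier F" and v: "v \<in> carrier F"
      using keys keys_diff[of u v] by auto
    then have d: "d \<in> carrier T" and w: "w \<in> carrier T"
      unfolding carrier_T d_def w_def by blast+
    have "d \<oplus>\<^bsub>T\<^esub> w = K #>\<^bsub>F\<^esub> u"
      using rcos_add[OF uv v] by (simp add: d_def w_def)
    then have "f d \<oplus>\<^bsub>G\<^esub> f w = g d \<oplus>\<^bsub>G\<^esub> f w"
      using f.hom_mult[of d w] g.hom_mult[of d w] d w eq_u eq_v by (simp add: w_def)
    then have "f d = g d"
      using f.hom_closed[of d] f.hom_closed[of w] g.hom_closed[of d] d w by simp
    then show "f (K #>\<^bsub>F\<^esub> (u - v)) = g (K #>\<^bsub>F\<^esub> (u - v))"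
      by (simp add: d_def)
  next
    fix p assume "p \<in> carrier M \<times> carrier N"
    then show "f (K #>\<^bsub>F\<^esub> frag_of p) = g (K #>\<^bsub>F\<^esub> frag_of p)"
      using eq by (auto simp: tens_def)
  qed
  then show ?thesis by (simp add: t)
qed

text \<open>The existence half: \<open>f\<close> extends additively from the generators to
  \<open>F\<close>; the extension kills the relators, hence \<open>K\<close>, and factors through
  the quotient.\<close>

lemma T_universal:
  assumes "abelian_group G"
    and f: "\<And>x y. \<lbrakk>x \<in> carrier M; y \<in> carrier N\<rbrakk> \<Longrightarrow> f x y \<in> carrier G"
    and add_left: "\<And>x x' y. \<lbrakk>x \<in> carrier M; x' \<in> carrier M; y \<in> carrier N\<rbrakk>
      \<Longrightarrow> f (x \<oplus>\<^bsub>M\<^esub> x') y = f x y \<oplus>\<^bsub>G\<^esub> f x' y"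
    and add_right: "\<And>x y y'. \<lbrakk>x \<in> carrier M; y \<in> carrier N; y' \<in> carrier N\<rbrakk>
      \<Longrightarrow> f x (y \<oplus>\<^bsub>N\<^esub> y') = f x y \<oplus>\<^bsub>G\<^esub> f x y'"
    and balanced: "\<And>x b y. \<lbrakk>x \<in> carrier M; b \<in> carrier B; y \<in> carrier N\<rbrakk>
      \<Longrightarrow> f (x \<odot>\<^sub>r\<^bsub>M\<^esub> b) y = f x (b \<odot>\<^bsub>N\<^esub> y)"
  obtains h where "h \<in> hom (add_monoid T) (add_monoid G)"
    and "\<And>x y. \<lbrakk>x \<in> carrier M; y \<in> carrier N\<rbrakk> \<Longrightarrow> h (tens x y) = f x y"
proof -
  interpret G: abelian_group G by fact
  obtain h where hom: "h \<in> hom F (add_monoid G)"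
    and h: "\<And>p. p \<in> carrier M \<times> carrier N \<Longrightarrow> h (frag_of p) = case_prod f p"
    using comm_group.free_Abelian_group_universal[OF G.a_comm_group,
        of "case_prod f" "carrier M \<times> carrier N"] f
    by (auto simp: image_subset_iff)
  interpret h: group_hom F "add_monoid G" h
    using hom by (auto simp: group_hom_def group_hom_axioms_def G.a_group)
  have diff: "h (u - v) = h u \<ominus>\<^bsub>G\<^esub> h v" "u - v \<in> carrier F"
    if "u \<in> carrier F" "v \<in> carrier F" for u v
  proof -
    show uv: "u - v \<in> carrier F" using that keys_diff[of u v] by auto
    show "h (u - v) = h u \<ominus>\<^bsub>G\<^esub> h v"
      using h.hom_mult[of "u - v" v] h.hom_closed[OF that(1)] h.hom_closed[OF that(2)]
        h.hom_closed[OF uv] that uv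
      by (simp add: a_minus_def G.a_assoc G.r_neg)
  qed
  \<comment> \<open>The shape that a biadditivity relator takes under \<open>h\<close> once
    \<open>add_left\<close> or \<open>add_right\<close> has been applied.\<close>
  have cancel: "a \<oplus>\<^bsub>G\<^esub> b \<ominus>\<^bsub>G\<^esub> a \<ominus>\<^bsub>G\<^esub> b = \<zero>\<^bsub>G\<^esub>"
    if "a \<in> carrier G" "b \<in> carrier G" for a b
    using that G.r_neg2 by (simp add: a_minus_def G.a_assoc G.a_comm[of a] G.r_neg)
  have "h u = \<zero>\<^bsub>G\<^esub>" if "u \<in> tensor_relators B M N" for u
    using that unfolding tensor_relators_def
    by (elim UnE CollectE exE conjE)
      (simp_all del: carrier_free_Abelian_group_iff
        add: diff h f add_left add_right balanced cancel G.r_neg[folded G.minus_eq]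
          M.rsmult_closed N.lsmult_closed)
  then have "tensor_relators B M N \<subseteq> kernel F (add_monoid G) h"
    using relators_subset by (auto simp: kernel_def simp del: carrier_free_Abelian_group_iff)
  then have "K \<subseteq> kernel F (add_monoid G) h"
    unfolding tensor_kernel_def
    by (rule group.generate_subgroup_incl[OF group_free_Abelian_group _ h.subgroup_kernel])
  then obtain k where "k \<in> hom (F Mod K) (add_monoid G)"
    and "\<And>u. u \<in> carrier F \<Longrightarrow> k (K #>\<^bsub>F\<^esub> u) = h u"
    using h.FactGroup_universal_kernel[OF K.normal_axioms] by blast
  then show thesis
    using that[of k] h by (simp add: hom_def T_FactGroup tens_def)
qed

section \<open>Descent of the outer actions to the quotient\<close>

text \<open>A map of generators that carries relators to relators extends to an endomorphism of
  \<open>F\<close> preserving \<open>K\<close>, so \<open>set_mult_image_rcos\<close> applies. Both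
  outer actions are instances.\<close>

lemma frag_extend_image_K:
  assumes \<alpha>: "\<And>p. p \<in> carrier M \<times> carrier N \<Longrightarrow> \<alpha> p \<in> carrier M \<times> carrier N"
    and rel: "\<And>u. u \<in> tensor_relators B M N \<Longrightarrow>
      frag_extend (frag_of \<circ> \<alpha>) u \<in> tensor_relators B M N"
    and u: "u \<in> carrier F"
  shows "K <#>\<^bsub>F\<^esub> frag_extend (frag_of \<circ> \<alpha>) ` (K #>\<^bsub>F\<^esub> u) =
      K #>\<^bsub>F\<^esub> frag_extend (frag_of \<circ> \<alpha>) u"
    and "frag_extend (frag_of \<circ> \<alpha>) u \<in> carrier F"
proof -
  let ?h = "frag_extend (frag_of \<circ> \<alpha>)"
  have closed: "?h v \<in> carrier F" if v: "v \<in> carrier F" for v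
  proof -
    have "\<alpha> p \<in> carrier M \<times> carrier N" if "p \<in> Poly_Mapping.keys v" for p
      using \<alpha>[of p] subsetD[OF v[unfolded carrier_free_Abelian_group_iff] that] by simp
    then have "(\<Union>p\<in>Poly_Mapping.keys v. Poly_Mapping.keys ((frag_of \<circ> \<alpha>) p)) \<subseteq> carrier M \<times> carrier N"
      by (intro UN_least) simp
    then show ?thesis
      using keys_frag_extend[of "frag_of \<circ> \<alpha>" v] by simp
  qed
  have hom: "?h \<in> hom F F"
    using closed by (auto simp: hom_def frag_extend_add)
  interpret h: group_hom F F ?h
    using hom by (auto simp: group_hom_def group_hom_axioms_def)
  have "?h ` tensor_relators B M N \<subseteq> tensor_relators B M N"
    using rel by (rule image_subsetI)
  \<comment> \<open>The image of a generated subgroup is generated by the image of its generators,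
    so preserving the relators is enough.\<close>
  then have "?h ` K \<subseteq> K"
    unfolding tensor_kernel_def h.generate_img[OF relators_subset, symmetric]
    by (rule group.mono_generate[OF group_free_Abelian_group])
  then show "K <#>\<^bsub>F\<^esub> ?h ` (K #>\<^bsub>F\<^esub> u) = K #>\<^bsub>F\<^esub> ?h u"
    by (rule K.set_mult_image_rcos[OF hom _ u])
  show "?h u \<in> carrier F" using closed[OF u] .
qed

text \<open>The action changes the left factor only. Biadditivity relators are preserved by
  distributivity, and balancing relators because the actions of \<open>R\<close> and
  \<open>B\<close> on \<open>M\<close> commute.\<close>

lemma smult_rcos:
  assumes r: "r \<in> carrier R" and u: "u \<in> carrier F"
  defines "h \<equiv> frag_extend (frag_of \<circ> (\<lambda>(x, y). (r \<odot>\<^bsub>M\<^esub> x, y)))"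
  shows "r \<odot>\<^bsub>T\<^esub> (K #>\<^bsub>F\<^esub> u) = K #>\<^bsub>F\<^esub> h u" and "h u \<in> carrier F"
proof -
  have closed: "(case p of (x, y) \<Rightarrow> (r \<odot>\<^bsub>M\<^esub> x, y)) \<in> carrier M \<times> carrier N"
    if "p \<in> carrier M \<times> carrier N" for p
    using that r by (auto simp: M.lsmult_closed)
  have rel: "frag_extend (frag_of \<circ> (\<lambda>(x, y). (r \<odot>\<^bsub>M\<^esub> x, y))) v \<in> tensor_relators B M N"
    if "v \<in> tensor_relators B M N" for v
    using that[unfolded tensor_relators_def] r
    by (elim UnE CollectE exE conjE)
      (simp_all add: frag_extend_diff relator_intros M.lsmult_closed M.lsmult_r_distr
        flip: M.smult_compat)
  show "r \<odot>\<^bsub>T\<^esub> (K #>\<^bsub>F\<^esub> u) = K #>\<^bsub>F\<^esub> h u" "h u \<in> carrier F"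
    using frag_extend_image_K[OF closed rel u]
    by (simp_all add: h_def tensor_product_def Let_def comp_def case_prod_unfold)
qed

text \<open>The mirror image, with commuting actions of \<open>B\<close> and \<open>S\<close> on
  \<open>N\<close>.\<close>

lemma rsmult_rcos:
  assumes s: "s \<in> carrier S" and u: "u \<in> carrier F"
  defines "h \<equiv> frag_extend (frag_of \<circ> (\<lambda>(x, y). (x, y \<odot>\<^sub>r\<^bsub>N\<^esub> s)))"
  shows "(K #>\<^bsub>F\<^esub> u) \<odot>\<^sub>r\<^bsub>T\<^esub> s = K #>\<^bsub>F\<^esub> h u" and "h u \<in> carrier F"
proof -
  have closed: "(case p of (x, y) \<Rightarrow> (x, y \<odot>\<^sub>r\<^bsub>N\<^esub> s)) \<in> carrier M \<times> carrier N"
    if "p \<in> carrier M \<times> carrier N" for p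
    using that s by (auto simp: N.rsmult_closed)
  have rel: "frag_extend (frag_of \<circ> (\<lambda>(x, y). (x, y \<odot>\<^sub>r\<^bsub>N\<^esub> s))) v \<in> tensor_relators B M N"
    if "v \<in> tensor_relators B M N" for v
    using that[unfolded tensor_relators_def] s
    by (elim UnE CollectE exE conjE)
      (simp_all add: frag_extend_diff relator_intros N.rsmult_closed N.rsmult_l_distr
        N.smult_compat)
  show "(K #>\<^bsub>F\<^esub> u) \<odot>\<^sub>r\<^bsub>T\<^esub> s = K #>\<^bsub>F\<^esub> h u" "h u \<in> carrier F"
    using frag_extend_image_K[OF closed rel u]
    by (simp_all add: h_def tensor_product_def Let_def comp_def case_prod_unfold)
qed

lemma smult_tens:
  "\<lbrakk>r \<in> carrier R; x \<in> carrier M; y \<in> carrier N\<rbrakk> \<Longrightarrow> r \<odot>\<^bsub>T\<^esub> tens x y = tens (r \<odot>\<^bsub>M\<^esub> x) y"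
  using smult_rcos(1)[of r "frag_of (x, y)"] by (simp add: tens_def)

lemma tens_rsmult:
  "\<lbrakk>x \<in> carrier M; y \<in> carrier N; s \<in> carrier S\<rbrakk> \<Longrightarrow> tens x y \<odot>\<^sub>r\<^bsub>T\<^esub> s = tens x (y \<odot>\<^sub>r\<^bsub>N\<^esub> s)"
  using rsmult_rcos(1)[of s "frag_of (x, y)"] by (simp add: tens_def)

text \<open>Additivity of the action is what makes \<open>T_hom_eqI\<close> applicable to the laws
  on \<open>T\<close>.\<close>

lemma smult_T_hom:
  assumes r: "r \<in> carrier R"
  shows "(\<lambda>t. r \<odot>\<^bsub>T\<^esub> t) \<in> hom (add_monoid T) (add_monoid T)"
proof (rule homI)
  fix t assume "t \<in> carrier (add_monoid T)"
  then show "r \<odot>\<^bsub>T\<^esub> t \<in> carrier (add_monoid T)"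
    using smult_rcos[OF r]
    by (auto simp: carrier_T simp del: carrier_free_Abelian_group_iff)
next
  fix t t' assume "t \<in> carrier (add_monoid T)" "t' \<in> carrier (add_monoid T)"
  then obtain u v where uv: "u \<in> carrier F" "v \<in> carrier F"
      and t: "t = K #>\<^bsub>F\<^esub> u" "t' = K #>\<^bsub>F\<^esub> v"
    by (auto simp: carrier_T simp del: carrier_free_Abelian_group_iff)
  have "u + v \<in> carrier F" using K.m_closed[OF uv] by simp
  then show "r \<odot>\<^bsub>T\<^esub> (t \<otimes>\<^bsub>add_monoid T\<^esub> t') =
      (r \<odot>\<^bsub>T\<^esub> t) \<otimes>\<^bsub>add_monoid T\<^esub> (r \<odot>\<^bsub>T\<^esub> t')"
    using uv smult_rcos[OF r]
    by (simp add: t rcos_add frag_extend_add del: carrier_free_Abelian_group_iff)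
qed

lemma rsmult_T_hom:
  assumes s: "s \<in> carrier S"
  shows "(\<lambda>t. t \<odot>\<^sub>r\<^bsub>T\<^esub> s) \<in> hom (add_monoid T) (add_monoid T)"
proof (rule homI)
  fix t assume "t \<in> carrier (add_monoid T)"
  then show "t \<odot>\<^sub>r\<^bsub>T\<^esub> s \<in> carrier (add_monoid T)"
    using rsmult_rcos[OF s]
    by (auto simp: carrier_T simp del: carrier_free_Abelian_group_iff)
next
  fix t t' assume "t \<in> carrier (add_monoid T)" "t' \<in> carrier (add_monoid T)"
  then obtain u v where uv: "u \<in> carrier F" "v \<in> carrier F"
      and t: "t = K #>\<^bsub>F\<^esub> u" "t' = K #>\<^bsub>F\<^esub> v"
    by (auto simp: carrier_T simp del: carrier_free_Abelian_group_iff)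
  have "u + v \<in> carrier F" using K.m_closed[OF uv] by simp
  then show "(t \<otimes>\<^bsub>add_monoid T\<^esub> t') \<odot>\<^sub>r\<^bsub>T\<^esub> s =
      (t \<odot>\<^sub>r\<^bsub>T\<^esub> s) \<otimes>\<^bsub>add_monoid T\<^esub> (t' \<odot>\<^sub>r\<^bsub>T\<^esub> s)"
    using uv rsmult_rcos[OF s]
    by (simp add: t rcos_add frag_extend_add del: carrier_free_Abelian_group_iff)
qed

lemmas smult_T_closed = hom_in_carrier[OF smult_T_hom, simplified]
lemmas rsmult_T_closed = hom_in_carrier[OF rsmult_T_hom, simplified]
lemmas smult_T_add = hom_mult[OF smult_T_hom, simplified]
lemmas rsmult_T_add = hom_mult[OF rsmult_T_hom, simplified]

text \<open>Apart from closure and additivity in the element of \<open>T\<close>, each law equates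
  two additive maps and is checked on elementary tensors. There it is a law of \<open>M\<close> or
  of \<open>N\<close>; the mixed law holds because the two actions touch different factors.\<close>

lemma bimodule_T: "bimodule R S T"
proof (intro bimodule.intro M.R.ring_axioms N.S.ring_axioms T.abelian_group_axioms
    bimodule_axioms.intro)
  note eqI = T_hom_eqI[OF T.abelian_group_axioms]
  \<comment> \<open>\<open>hom_def\<close> opens the premises of \<open>eqI\<close> that both sides
    are additive; \<open>T.a_ac\<close> rearranges the sums of two actions.\<close>
  note rules = hom_def smult_T_closed rsmult_T_closed smult_T_add rsmult_T_add T.a_ac
    smult_tens tens_rsmult tens_add_left tens_add_right
    M.lsmult_closed N.rsmult_closed
    M.lsmult_l_distr M.lsmult_assoc M.lsmult_one N.rsmult_r_distr N.rsmult_assoc N.rsmult_one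
  fix t assume t: "t \<in> carrier T"
  show "\<one>\<^bsub>R\<^esub> \<odot>\<^bsub>T\<^esub> t = t"
    by (rule eqI[OF _ _ _ t]) (simp_all add: rules)
  show "t \<odot>\<^sub>r\<^bsub>T\<^esub> \<one>\<^bsub>S\<^esub> = t"
    by (rule eqI[OF _ _ _ t]) (simp_all add: rules)
  {
    fix r r' assume r: "r \<in> carrier R" "r' \<in> carrier R"
    show "(r \<oplus>\<^bsub>R\<^esub> r') \<odot>\<^bsub>T\<^esub> t = r \<odot>\<^bsub>T\<^esub> t \<oplus>\<^bsub>T\<^esub> r' \<odot>\<^bsub>T\<^esub> t"
      by (rule eqI[OF _ _ _ t]) (use r in \<open>simp_all add: rules\<close>)
    show "(r \<otimes>\<^bsub>R\<^esub> r') \<odot>\<^bsub>T\<^esub> t = r \<odot>\<^bsub>T\<^esub> (r' \<odot>\<^bsub>T\<^esub> t)"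
      by (rule eqI[OF _ _ _ t]) (use r in \<open>simp_all add: rules\<close>)
  next
    fix s s' assume s: "s \<in> carrier S" "s' \<in> carrier S"
    show "t \<odot>\<^sub>r\<^bsub>T\<^esub> (s \<oplus>\<^bsub>S\<^esub> s') = t \<odot>\<^sub>r\<^bsub>T\<^esub> s \<oplus>\<^bsub>T\<^esub> t \<odot>\<^sub>r\<^bsub>T\<^esub> s'"
      by (rule eqI[OF _ _ _ t]) (use s in \<open>simp_all add: rules\<close>)
    show "t \<odot>\<^sub>r\<^bsub>T\<^esub> (s \<otimes>\<^bsub>S\<^esub> s') = (t \<odot>\<^sub>r\<^bsub>T\<^esub> s) \<odot>\<^sub>r\<^bsub>T\<^esub> s'"
      by (rule eqI[OF _ _ _ t]) (use s in \<open>simp_all add: rules\<close>)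
  next
    fix r s assume rs: "r \<in> carrier R" "s \<in> carrier S"
    show "(r \<odot>\<^bsub>T\<^esub> t) \<odot>\<^sub>r\<^bsub>T\<^esub> s = r \<odot>\<^bsub>T\<^esub> (t \<odot>\<^sub>r\<^bsub>T\<^esub> s)"
      by (rule eqI[OF _ _ _ t]) (use rs in \<open>simp_all add: rules\<close>)
  }
qed (simp_all add: smult_T_closed rsmult_T_closed smult_T_add rsmult_T_add)

end

section \<open>The tensor square of a tower\<close>

text \<open>The half of the H-equivalence that holds for every tower, by retraction along
  multiplication.\<close>

lemma (in ring_tower) tower_bimodule_iso_to_summand:
  assumes "n > 0"
  shows "iso_to_summand A C (tower_bimodule A \<phi> \<psi>) (bimodule_power (tower_tensor A B \<phi> \<psi>) n)"
proof -
  define M where "M = natural_bimodule A (\<lambda>a. a) \<psi>"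
  define N where "N = natural_bimodule A \<psi> (\<psi> \<circ> \<phi>)"
  define D where "D = tower_bimodule A \<phi> \<psi>"
  have id: "(\<lambda>a. a) \<in> ring_hom A A"
    by (simp add: ring_hom_def)
  have comp: "\<psi> \<circ> \<phi> \<in> ring_hom C A"
    using ring_hom_trans[OF lower_hom upper_hom] .
  interpret M: bimodule A B M
    unfolding M_def
    by (rule natural_bimodule_bimodule[OF A.ring_axioms A.ring_axioms B.ring_axioms id upper_hom])
  interpret N: bimodule B C N
    unfolding N_def
    by (rule natural_bimodule_bimodule[OF A.ring_axioms B.ring_axioms C.ring_axioms upper_hom comp])
  interpret D: bimodule A C D
    unfolding D_def tower_bimodule_def
    by (rule natural_bimodule_bimodule[OF A.ring_axioms A.ring_axioms C.ring_axioms id comp])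
  interpret tensor A B C M N ..
  have T: "tower_tensor A B \<phi> \<psi> = T"
    by (simp add: tower_tensor_def M_def N_def)
  have M_simps: "carrier M = carrier A" "add M = add A"
      "\<And>a x. a \<odot>\<^bsub>M\<^esub> x = a \<otimes>\<^bsub>A\<^esub> x" "\<And>x b. x \<odot>\<^sub>r\<^bsub>M\<^esub> b = x \<otimes>\<^bsub>A\<^esub> \<psi> b"
    and N_simps: "carrier N = carrier A" "add N = add A"
      "\<And>b x. b \<odot>\<^bsub>N\<^esub> x = \<psi> b \<otimes>\<^bsub>A\<^esub> x" "\<And>x c. x \<odot>\<^sub>r\<^bsub>N\<^esub> c = x \<otimes>\<^bsub>A\<^esub> \<psi> (\<phi> c)"
    and D_simps: "carrier D = carrier A" "add D = add A"
      "\<And>a x. a \<odot>\<^bsub>D\<^esub> x = a \<otimes>\<^bsub>A\<^esub> x" "\<And>x c. x \<odot>\<^sub>r\<^bsub>D\<^esub> c = x \<otimes>\<^bsub>A\<^esub> \<psi> (\<phi> c)"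
    by (simp_all add: M_def N_def D_def tower_bimodule_def natural_bimodule_def)
  note simps = M_simps N_simps D_simps
  have \<psi>: "\<psi> b \<in> carrier A" if "b \<in> carrier B" for b
    using ring_hom_closed[OF upper_hom that] .
  have \<phi>: "\<phi> c \<in> carrier B" if "c \<in> carrier C" for c
    using ring_hom_closed[OF lower_hom that] .
  \<comment> \<open>Multiplication of \<open>A\<close> is biadditive by distributivity and balanced
    by associativity, so it descends to \<open>T\<close>.\<close>
  obtain \<mu> where hom: "\<mu> \<in> hom (add_monoid T) (add_monoid D)"
    and \<mu>: "\<And>x y. \<lbrakk>x \<in> carrier A; y \<in> carrier A\<rbrakk> \<Longrightarrow> \<mu> (tens x y) = x \<otimes>\<^bsub>A\<^esub> y"
    using T_universal[OF D.M.abelian_group_axioms, of "\<lambda>x y. x \<otimes>\<^bsub>A\<^esub> y"]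
    by (auto simp: simps A.l_distr A.r_distr A.m_assoc \<psi>)
  have \<mu>_closed: "\<mu> t \<in> carrier A" if "t \<in> carrier T" for t
    using hom_in_carrier[OF hom] that by (simp add: simps)
  have \<mu>_add: "\<mu> (t \<oplus>\<^bsub>T\<^esub> t') = \<mu> t \<oplus>\<^bsub>A\<^esub> \<mu> t'" if "t \<in> carrier T" "t' \<in> carrier T" for t t'
    using hom_mult[OF hom] that by (simp add: simps)
  have \<iota>: "(\<lambda>a. tens a \<one>\<^bsub>A\<^esub>) \<in> bimodule_hom A C D T"
  proof (rule bimodule_homI)
    fix x c assume x: "x \<in> carrier D" and c: "c \<in> carrier C"
    \<comment> \<open>The tower enters here: \<open>C\<close> acts through \<open>B\<close>, so
      balancing moves the scalar across the tensor sign onto the factor 1, where the right action of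
      \<open>c\<close> also places it.\<close>
    then have "tens (x \<otimes>\<^bsub>A\<^esub> \<psi> (\<phi> c)) \<one>\<^bsub>A\<^esub> = tens x (\<psi> (\<phi> c))"
      using tens_balanced[of x "\<phi> c" "\<one>\<^bsub>A\<^esub>"] by (simp add: simps \<phi> \<psi>)
    then show "tens (x \<odot>\<^sub>r\<^bsub>D\<^esub> c) \<one>\<^bsub>A\<^esub> = tens x \<one>\<^bsub>A\<^esub> \<odot>\<^sub>r\<^bsub>T\<^esub> c"
      using x c tens_rsmult[of x "\<one>\<^bsub>A\<^esub>" c] by (simp add: simps \<phi> \<psi>)
  qed (use tens_add_left smult_tens in \<open>simp_all add: simps\<close>)
  have \<mu>_hom: "\<mu> \<in> bimodule_hom A C T D"
  proof (rule bimodule_homI)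
    fix a t assume a: "a \<in> carrier A" and t: "t \<in> carrier T"
    \<comment> \<open>Both sides are additive in \<open>t\<close>; on elementary tensors the
      equation is associativity in \<open>A\<close>.\<close>
    show "\<mu> (a \<odot>\<^bsub>T\<^esub> t) = a \<odot>\<^bsub>D\<^esub> \<mu> t"
      by (rule T_hom_eqI[OF D.M.abelian_group_axioms _ _ _ t])
        (use a in \<open>auto simp: hom_def simps \<mu> \<mu>_closed \<mu>_add smult_T_closed smult_T_add
          smult_tens A.r_distr A.m_assoc\<close>)
  next
    fix c t assume c: "c \<in> carrier C" and t: "t \<in> carrier T"
    show "\<mu> (t \<odot>\<^sub>r\<^bsub>T\<^esub> c) = \<mu> t \<odot>\<^sub>r\<^bsub>D\<^esub> c"
      by (rule T_hom_eqI[OF D.M.abelian_group_axioms _ _ _ t])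
        (use c in \<open>auto simp: hom_def simps \<mu> \<mu>_closed \<mu>_add rsmult_T_closed rsmult_T_add
          tens_rsmult A.l_distr A.m_assoc \<phi> \<psi>\<close>)
  qed (simp_all add: simps \<mu>_closed \<mu>_add)
  \<comment> \<open>The retraction identity amounts to multiplying \<open>a\<close> by the identity
    of \<open>A\<close>.\<close>
  show ?thesis
    unfolding T D_def[symmetric]
    by (rule retract_iso_to_summand_power[OF D.bimodule_axioms bimodule_T \<iota> \<mu>_hom _ assms])
      (simp add: simps \<mu>)
qed

theorem lemma2p2:
  assumes "ring_tower A B C \<phi> \<psi>"
  shows "right_depth_three A B C \<phi> \<psi> \<longleftrightarrow>
    H_equivalent A C (tower_tensor A B \<phi> \<psi>) (tower_bimodule A \<phi> \<psi>)"
proof -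
  interpret ring_tower A B C \<phi> \<psi> by fact
  show ?thesis
    \<comment> \<open>After unfolding, the first conjunct of \<open>H_equivalent\<close> is depth
      three itself; the second is supplied with \<open>m = 1\<close>.\<close>
    unfolding right_depth_three_def H_equivalent_def
    using tower_bimodule_iso_to_summand[OF zero_less_one] zero_less_one by blast
qed

end
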